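(* Let $X$ be a complex Banach space and let $A\subseteq B(X)$ be an abelian, unital, norm closed subalgebra with spectral synthesis. If $A$ has split strict multiplicity $s.s.m.(A)=2$, then $A$ is hereditarily reflexive.
   Context: $B(X)$ is the algebra of bounded linear operators on $X$; $A$ carries the operator norm; "strongly closed" means closed in the strong operator topology of $B(X)$. An algebra $A\subset B(X)$ has split strict multiplicity $2$, written $s.s.m.(A)=2$, if there are $x_1,x_2\in X$ such that the subspaces $X_i=\{ax_i : a\in A\}$, $i=1,2$, are closed and $X=X_1\oplus X_2$. $A$ (as an abelian unital Banach algebra) has spectral synthesis if every norm closed ideal of $A$ is the intersection of the maximal ideals of $A$ containing it. A linear subspace $\mathcal{L}\subseteq B(X)$ is reflexive if every $T\in B(X)$ satisfying $Tx\in\overline{\mathcal{L}x}$ for every $x\in X$ belongs to $\mathcal{L}$. The algebra $A$ is hereditarily reflexive if every strongly closed subspace $\mathcal{L}\subseteq A$ is reflexive. *)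

theory Defs
  imports "HOL-Analysis.Analysis"
begin

section \<open>Complex Banach spaces\<close>

class complex_normed_vector = real_normed_vector +
  fixes scaleC :: "complex \<Rightarrow> 'a \<Rightarrow> 'a"  (infixr "*\<^sub>C" 75)
  assumes scaleC_add_right: "c *\<^sub>C (x + y) = c *\<^sub>C x + c *\<^sub>C y"
    and scaleC_add_left: "(c + d) *\<^sub>C x = c *\<^sub>C x + d *\<^sub>C x"
    and scaleC_scaleC: "c *\<^sub>C d *\<^sub>C x = (c * d) *\<^sub>C x"
    and scaleC_of_real: "of_real r *\<^sub>C x = r *\<^sub>R x"
    and norm_scaleC: "norm (c *\<^sub>C x) = cmod c * norm x"

class complex_banach = complex_normed_vector + banach

instantiation complex :: complex_banach
begin

definition scaleC_complex :: "complex \<Rightarrow> complex \<Rightarrow> complex"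
  where "scaleC_complex c x = c * x"

instance
  by standard (auto simp: scaleC_complex_def algebra_simps norm_mult scaleR_conv_of_real)

end

global_interpretation complex_vector:
  vector_space "scaleC :: complex \<Rightarrow> 'a \<Rightarrow> 'a :: complex_normed_vector"
  defines csubspace = complex_vector.subspace
proof
  fix x :: 'a
  show "1 *\<^sub>C x = x"
    using scaleC_of_real[of 1 x] by simp
qed (simp_all add: scaleC_add_right scaleC_add_left scaleC_scaleC)

lemma bounded_linear_scaleC:
  "bounded_linear (\<lambda>x :: 'a :: complex_normed_vector. c *\<^sub>C x)"
proof (rule bounded_linear_intro[where K = "cmod c"])
  fix r :: real and x y :: 'a
  show "c *\<^sub>C (x + y) = c *\<^sub>C x + c *\<^sub>C y"
    by (rule scaleC_add_right)
  show "c *\<^sub>C (r *\<^sub>R x) = r *\<^sub>R (c *\<^sub>C x)"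
    by (simp flip: scaleC_of_real add: scaleC_scaleC mult.commute)
  show "norm (c *\<^sub>C x) \<le> norm x * cmod c"
    by (simp add: norm_scaleC mult.commute)
qed

instantiation blinfun :: (real_normed_vector, complex_normed_vector) complex_normed_vector
begin

lift_definition scaleC_blinfun :: "complex \<Rightarrow> 'a \<Rightarrow>\<^sub>L 'b \<Rightarrow> 'a \<Rightarrow>\<^sub>L 'b"
  is "\<lambda>c f x. c *\<^sub>C f x"
  by (rule bounded_linear_compose[OF bounded_linear_scaleC])

instance
proof
  fix c d :: complex and r :: real and f g :: "'a \<Rightarrow>\<^sub>L 'b"
  show "c *\<^sub>C (f + g) = c *\<^sub>C f + c *\<^sub>C g"
    by transfer (simp add: scaleC_add_right)
  show "(c + d) *\<^sub>C f = c *\<^sub>C f + d *\<^sub>C f"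
    by transfer (simp add: scaleC_add_left)
  show "c *\<^sub>C d *\<^sub>C f = (c * d) *\<^sub>C f"
    by transfer (simp add: scaleC_scaleC)
  show "of_real r *\<^sub>C f = r *\<^sub>R f"
    by transfer (simp add: scaleC_of_real)
  have le: "norm (c *\<^sub>C f) \<le> cmod c * norm f" for c and f :: "'a \<Rightarrow>\<^sub>L 'b"
    by (rule norm_blinfun_bound)
      (auto simp: scaleC_blinfun.rep_eq norm_scaleC mult.assoc
        intro!: mult_left_mono norm_blinfun)
  show "norm (c *\<^sub>C f) = cmod c * norm f"
  proof (cases "c = 0")
    case True
    then show ?thesis using le[of c f] by simp
  next
    case False
    have "inverse c *\<^sub>C c *\<^sub>C f = f"
      using False by transfer (simp add: scaleC_scaleC)
    then have "norm f \<le> cmod (inverse c) * norm (c *\<^sub>C f)"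
      using le[of "inverse c" "c *\<^sub>C f"] by simp
    then have "cmod c * norm f \<le> norm (c *\<^sub>C f)"
      using False by (simp add: norm_divide field_simps)
    with le[of c f] show ?thesis by simp
  qed
qed

end

section \<open>Algebras of bounded operators\<close>

text \<open>The type \<open>'a \<Rightarrow>\<^sub>L 'a\<close> consists of the bounded \<^emph>\<open>real\<close>-linear maps; \<open>B(X)\<close> is its subset of
  complex-linear ones. The norm of \<open>'a \<Rightarrow>\<^sub>L 'a\<close> restricts to the operator norm of \<open>B(X)\<close>, and
  likewise for the strong operator topology.\<close>

definition bounded_ops :: "('a :: complex_normed_vector \<Rightarrow>\<^sub>L 'a) set"
  where "bounded_ops = {T. Vector_Spaces.linear scaleC scaleC (blinfun_apply T)}"

definition strongly_closed :: "('a :: complex_normed_vector \<Rightarrow>\<^sub>L 'a) set \<Rightarrow> bool"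
  where "strongly_closed L \<longleftrightarrow> closedin (subtopology strong_operator_topology bounded_ops) L"

definition subalgebra :: "('a :: complex_normed_vector \<Rightarrow>\<^sub>L 'a) set \<Rightarrow> bool"
  where "subalgebra A \<longleftrightarrow>
    A \<subseteq> bounded_ops \<and> csubspace A \<and> (\<forall>a\<in>A. \<forall>b\<in>A. a o\<^sub>L b \<in> A)"

definition unital :: "('a :: complex_normed_vector \<Rightarrow>\<^sub>L 'a) set \<Rightarrow> bool"
  where "unital A \<longleftrightarrow> id_blinfun \<in> A"

definition abelian :: "('a :: complex_normed_vector \<Rightarrow>\<^sub>L 'a) set \<Rightarrow> bool"
  where "abelian A \<longleftrightarrow> (\<forall>a\<in>A. \<forall>b\<in>A. a o\<^sub>L b = b o\<^sub>L a)"

definition algebra_ideal ::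
    "('a :: complex_normed_vector \<Rightarrow>\<^sub>L 'a) set \<Rightarrow> ('a \<Rightarrow>\<^sub>L 'a) set \<Rightarrow> bool"
  where "algebra_ideal A I \<longleftrightarrow>
    I \<subseteq> A \<and> csubspace I \<and> (\<forall>a\<in>A. \<forall>b\<in>I. a o\<^sub>L b \<in> I \<and> b o\<^sub>L a \<in> I)"

definition maximal_ideal ::
    "('a :: complex_normed_vector \<Rightarrow>\<^sub>L 'a) set \<Rightarrow> ('a \<Rightarrow>\<^sub>L 'a) set \<Rightarrow> bool"
  where "maximal_ideal A M \<longleftrightarrow>
    algebra_ideal A M \<and> M \<noteq> A \<and>
    (\<forall>J. algebra_ideal A J \<and> M \<subseteq> J \<longrightarrow> J = M \<or> J = A)"

text \<open>The intersection is formed inside \<open>A\<close>, so that the empty intersection, which arises for the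
  improper ideal \<open>I = A\<close>, is \<open>A\<close>.\<close>

definition spectral_synthesis :: "('a :: complex_normed_vector \<Rightarrow>\<^sub>L 'a) set \<Rightarrow> bool"
  where "spectral_synthesis A \<longleftrightarrow>
    (\<forall>I. algebra_ideal A I \<and> closed I \<longrightarrow> I = A \<inter> \<Inter>{M. maximal_ideal A M \<and> I \<subseteq> M})"

definition orbit :: "('a :: complex_normed_vector \<Rightarrow>\<^sub>L 'a) set \<Rightarrow> 'a \<Rightarrow> 'a set"
  where "orbit L x = (\<lambda>a. blinfun_apply a x) ` L"

definition direct_sum_decomposition :: "'a :: complex_normed_vector set \<Rightarrow> 'a set \<Rightarrow> bool"
  where "direct_sum_decomposition U V \<longleftrightarrow> {u + v | u v. u \<in> U \<and> v \<in> V} = UNIV \<and> U \<inter> V = {0}"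

definition split_strict_multiplicity_two :: "('a :: complex_normed_vector \<Rightarrow>\<^sub>L 'a) set \<Rightarrow> bool"
  where "split_strict_multiplicity_two A \<longleftrightarrow>
    (\<exists>x\<^sub>1 x\<^sub>2. closed (orbit A x\<^sub>1) \<and> closed (orbit A x\<^sub>2) \<and>
      direct_sum_decomposition (orbit A x\<^sub>1) (orbit A x\<^sub>2))"

definition reflexive :: "('a :: complex_normed_vector \<Rightarrow>\<^sub>L 'a) set \<Rightarrow> bool"
  where "reflexive L \<longleftrightarrow>
    (\<forall>T\<in>bounded_ops. (\<forall>x. blinfun_apply T x \<in> closure (orbit L x)) \<longrightarrow> T \<in> L)"

definition hereditarily_reflexive :: "('a :: complex_normed_vector \<Rightarrow>\<^sub>L 'a) set \<Rightarrow> bool"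
  where "hereditarily_reflexive A \<longleftrightarrow>
    (\<forall>L. csubspace L \<and> L \<subseteq> A \<and> strongly_closed L \<longrightarrow> reflexive L)"

end

theory Submission
  imports Defs
begin

text \<open>
  Let \<open>T\<close> satisfy \<open>T x \<in> closure (\<L> x)\<close> for all \<open>x\<close>, and let \<open>x\<^sub>1, x\<^sub>2\<close> be as in the definition of
  split strict multiplicity. On each \<open>X\<^sub>i = A x\<^sub>i\<close> the operator \<open>T\<close> commutes with \<open>A\<close>: write
  \<open>T x\<^sub>i = t x\<^sub>i\<close> and \<open>T a x\<^sub>i = b x\<^sub>i\<close>. By spectral synthesis of the annihilator of \<open>x\<^sub>i\<close> it is enough
  that \<open>b - a t\<close> lies in every maximal ideal \<open>M\<close> containing this annihilator. By Gelfand-Mazur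
  \<open>a - \<lambda> \<in> M\<close> for some \<open>\<lambda>\<close>; hence \<open>T (a - \<lambda>) x\<^sub>i\<close> lies in the closure of \<open>M x\<^sub>i\<close>, which is closed by the
  open mapping theorem, so \<open>b - \<lambda> t \<in> M\<close> and therefore \<open>b - a t \<in> M\<close>.
  Finally choose \<open>l\<^sub>n \<in> \<L>\<close> with \<open>l\<^sub>n (x\<^sub>1 + x\<^sub>2) \<longlonglongrightarrow> T (x\<^sub>1 + x\<^sub>2)\<close>. The projections onto \<open>X\<^sub>1\<close> and \<open>X\<^sub>2\<close> are
  bounded, so \<open>l\<^sub>n x\<^sub>i \<longlonglongrightarrow> T x\<^sub>i\<close>, and commutation with \<open>A\<close> gives \<open>l\<^sub>n \<longlonglongrightarrow> T\<close> strongly.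
\<close>

section \<open>Open mapping theorem\<close>

text \<open>The Baire half of the open mapping theorem. The closed range is complete and is the
  union of the sets \<open>G n\<close>, so some \<open>G n\<close> has interior relative to the
  range; moving that interior to the origin and rescaling gives preimages of controlled norm, up to
  any error \<open>e\<close>.\<close>

lemma closed_image_approx_bound:
  fixes f :: "'a::real_normed_vector \<Rightarrow> 'b::banach"
  assumes f: "bounded_linear f" and S: "subspace S" and closed: "closed (f ` S)"
  shows "\<exists>K>0. \<forall>y\<in>f ` S. \<forall>e>0. \<exists>x\<in>S. norm x \<le> K * norm y \<and> norm (y - f x) < e"
proof -
  interpret f: bounded_linear f by (rule f)
  let ?Y = "top_of_set (f ` S)"
  define G where "G n = closure (f ` (S \<inter> cball 0 (real n)))" for n :: nat
  have sub: "G n \<subseteq> f ` S" for n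
    unfolding G_def using closed by (intro closure_minimal) auto
  have "f ` S \<subseteq> (\<Union>n. G n)"
  proof
    fix y assume "y \<in> f ` S"
    then obtain x where x: "x \<in> S" "y = f x" by blast
    obtain n where "norm x \<le> real n" using real_arch_simple by blast
    with x have "y \<in> G n"
      unfolding G_def by (intro subsetD[OF closure_subset]) (auto simp: dist_norm)
    then show "y \<in> (\<Union>n. G n)" by blast
  qed
  with sub have UG: "\<Union>(range G) = f ` S" by blast
  have ne: "f ` S \<noteq> {}"
    using subspace_0[OF S] by blast
  have "\<exists>n. ?Y interior_of (G n) \<noteq> {}"
  proof (rule ccontr)
    assume *: "\<nexists>n. ?Y interior_of (G n) \<noteq> {}"
    have "?Y interior_of \<Union>(range G) = {}"
    proof (rule Baire_category_alt)
      show "completely_metrizable_space ?Y \<or> locally_compact_space ?Y \<and> regular_space ?Y"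
        using closed closed_closedin completely_metrizable_space_closedin
          completely_metrizable_space_euclidean by blast
      show "closedin ?Y T \<and> ?Y interior_of T = {}" if T: "T \<in> range G" for T
      proof
        show "closedin ?Y T"
          using T sub by (auto simp: G_def intro!: closed_subset)
        show "?Y interior_of T = {}"
          using T * by blast
      qed
    qed auto
    then show False
      using UG ne by (metis interior_of_topspace topspace_euclidean_subtopology)
  qed
  then obtain n y0 where y0: "y0 \<in> ?Y interior_of (G n)" by blast
  have "openin ?Y (?Y interior_of (G n))" by simp
  from this[unfolded openin_euclidean_subtopology_iff] y0
  have "\<exists>r>0. \<forall>y\<in>f ` S. dist y y0 < r \<longrightarrow> y \<in> ?Y interior_of (G n)"
    by (elim conjE) (rule bspec)
  then obtain r where r: "r > 0"
    "\<And>y. y \<in> f ` S \<Longrightarrow> dist y y0 < r \<Longrightarrow> y \<in> ?Y interior_of (G n)" by auto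
  have y0S: "y0 \<in> f ` S" "y0 \<in> G n"
    using subsetD[OF interior_of_subset y0] sub by auto
  have YS: "subspace (f ` S)"
    using S f.linear_axioms by (rule linear_subspace_image[rotated])
  have approx: "\<exists>x\<in>S. norm x \<le> real n \<and> norm (z - f x) < e" if "z \<in> G n" "e > 0" for z e
  proof -
    obtain v where "v \<in> f ` (S \<inter> cball 0 (real n))" "dist v z < e"
      using \<open>z \<in> G n\<close> \<open>e > 0\<close> unfolding G_def closure_approachable by blast
    then show ?thesis by (auto simp: dist_norm norm_minus_commute)
  qed
  \<comment> \<open>\<open>y\<close> is the difference of \<open>y0 + y\<close> and
    \<open>y0\<close>, both in \<open>G n\<close>; hence the factor 2.\<close>
  have small: "\<exists>x\<in>S. norm x \<le> 2 * real n \<and> norm (y - f x) < e"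
    if y: "y \<in> f ` S" "norm y < r" and e: "e > 0" for y e
  proof -
    have "y0 + y \<in> f ` S"
      using YS y0S(1) y(1) by (rule subspace_add)
    then have "y0 + y \<in> G n"
      using subsetD[OF interior_of_subset r(2)] y(2) by (simp add: dist_norm)
    with y0S(2) obtain x1 x2 where x1: "x1 \<in> S" "norm x1 \<le> n" "norm (y0 + y - f x1) < e / 2"
      and x2: "x2 \<in> S" "norm x2 \<le> n" "norm (y0 - f x2) < e / 2"
      using approx[OF _ half_gt_zero[OF e]] by meson
    have "norm (x1 - x2) \<le> 2 * real n"
      using norm_triangle_ineq4[of x1 x2] x1 x2 by simp
    moreover have "norm (y - f (x1 - x2)) < e"
    proof -
      have eq: "y - f (x1 - x2) = (y0 + y - f x1) - (y0 - f x2)"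
        by (simp add: f.diff)
      show ?thesis
        unfolding eq by (rule order_le_less_trans[OF norm_triangle_ineq4]) (use x1 x2 in linarith)
    qed
    ultimately show ?thesis
      using subspace_diff[OF S x1(1) x2(1)] by blast
  qed
  \<comment> \<open>With \<open>c = r / (2 * norm y)\<close> below, \<open>2 * n / c\<close> equals
    \<open>4 * n / r * norm y\<close>; the added 1 keeps \<open>K\<close> positive when
    \<open>n = 0\<close>.\<close>
  define K where "K = 4 * real n / r + 1"
  have K: "K > 0" "4 * real n / r \<le> K" using r(1) by (simp_all add: K_def add_nonneg_pos)
  have "\<exists>x\<in>S. norm x \<le> K * norm y \<and> norm (y - f x) < e"
    if y: "y \<in> f ` S" and e: "e > 0" for y e
  proof (cases "y = 0")
    case True
    then show ?thesis using e subspace_0[OF S] by (auto simp: f.zero)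
  next
    case False
    define c where "c = r / (2 * norm y)"
    have c: "c > 0" using False r by (simp add: c_def)
    have "norm (c *\<^sub>R y) < r"
      using False r c by (simp add: c_def)
    then obtain x where x: "x \<in> S" "norm x \<le> 2 * real n" "norm (c *\<^sub>R y - f x) < c * e"
      using small[of "c *\<^sub>R y" "c * e"] subspace_scale[OF YS y] c e by auto
    have "norm (x /\<^sub>R c) \<le> 2 * real n / c"
      using x c by (simp add: field_simps)
    also have "\<dots> = (4 * real n / r) * norm y"
      using False r by (simp add: c_def)
    also have "\<dots> \<le> K * norm y"
      using K by (intro mult_right_mono) auto
    finally have "norm (x /\<^sub>R c) \<le> K * norm y" .
    moreover have "norm (y - f (x /\<^sub>R c)) < e"
    proof -
      have eq: "y - f (x /\<^sub>R c) = (c *\<^sub>R y - f x) /\<^sub>R c"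
        using c by (simp add: f.scaleR scaleR_diff_right)
      have "inverse c * norm (c *\<^sub>R y - f x) < inverse c * (c * e)"
        using x(3) c by (intro mult_strict_left_mono) auto
      also have "\<dots> = e" using c by simp
      finally show ?thesis
        unfolding eq using c by simp
    qed
    ultimately show ?thesis
      using subspace_scale[OF S x(1)] by (intro bexI[of _ "x /\<^sub>R c"] conjI)
  qed
  then show ?thesis
    using K(1) by (intro exI[of _ K] conjI ballI allI impI)
qed

text \<open>Successive approximation: every correction halves the remaining error, so the
  corrections are dominated by a geometric series and their sum stays in the closed subspace
  \<open>S\<close>.\<close>

theorem open_mapping_closed_subspace:
  fixes f :: "'a::banach \<Rightarrow> 'b::banach"
  assumes f: "bounded_linear f" and S: "subspace S" "closed S" and closed: "closed (f ` S)"
  obtains C where "C > 0" "\<forall>y\<in>f ` S. \<exists>x\<in>S. f x = y \<and> norm x \<le> C * norm y"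
proof -
  interpret f: bounded_linear f by (rule f)
  obtain K where K: "K > 0"
    "\<And>y e. y \<in> f ` S \<Longrightarrow> e > 0 \<Longrightarrow> \<exists>x\<in>S. norm x \<le> K * norm y \<and> norm (y - f x) < e"
    using closed_image_approx_bound[OF f S(1) closed] by blast
  have YS: "subspace (f ` S)"
    using S(1) f.linear_axioms by (rule linear_subspace_image[rotated])
  have "\<exists>x\<in>S. f x = y \<and> norm x \<le> 2 * K * norm y" if y: "y \<in> f ` S" for y
  proof (cases "y = 0")
    case True
    then show ?thesis using subspace_0[OF S(1)] f.zero by force
  next
    case False
    \<comment> \<open>The clause for \<open>n = 0\<close> pins the start of the sequence to 0, on
      which the telescoping sum and the final norm bound rely.\<close>
    have "\<exists>X. \<forall>n. (X n \<in> S \<and> norm (y - f (X n)) \<le> norm y / 2 ^ n \<and> (n = 0 \<longrightarrow> X n = 0)) \<and>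
        norm (X (Suc n) - X n) \<le> K * norm y / 2 ^ n"
    proof (rule dependent_nat_choice)
      show "\<exists>x. x \<in> S \<and> norm (y - f x) \<le> norm y / 2 ^ 0 \<and> (0 = (0 :: nat) \<longrightarrow> x = 0)"
        using subspace_0[OF S(1)] by (auto simp: f.zero intro!: exI[of _ 0])
    next
      fix x and n :: nat assume x: "x \<in> S \<and> norm (y - f x) \<le> norm y / 2 ^ n \<and> (n = 0 \<longrightarrow> x = 0)"
      then have "y - f x \<in> f ` S"
        using y by (intro subspace_diff[OF YS]) auto
      then obtain z where z: "z \<in> S" "norm z \<le> K * norm (y - f x)"
          "norm (y - f x - f z) < norm y / 2 ^ Suc n"
        using K(2)[of "y - f x" "norm y / 2 ^ Suc n"] False by auto
      have "K * norm (y - f x) \<le> K * (norm y / 2 ^ n)"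
        using x K by (intro mult_left_mono) auto
      with x z show "\<exists>x'. (x' \<in> S \<and> norm (y - f x') \<le> norm y / 2 ^ Suc n \<and>
          (Suc n = 0 \<longrightarrow> x' = 0)) \<and> norm (x' - x) \<le> K * norm y / 2 ^ n"
        by (intro exI[of _ "x + z"]) (auto simp: f.add algebra_simps subspace_add[OF S(1)])
    qed
    then obtain X where X: "\<And>n. X n \<in> S" "\<And>n. norm (y - f (X n)) \<le> norm y / 2 ^ n" "X 0 = 0"
      "\<And>n. norm (X (Suc n) - X n) \<le> K * norm y / 2 ^ n" by blast
    have "summable (\<lambda>n. X (Suc n) - X n)"
    proof (rule summable_comparison_test')
      show "summable (\<lambda>n. K * norm y * (1 / 2) ^ n)"
        by (intro summable_mult summable_geometric) simp
      show "norm (X (Suc n) - X n) \<le> K * norm y * (1 / 2) ^ n" if "n \<ge> 0" for n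
        using X(4)[of n] by (simp add: power_one_over)
    qed
    then have "(\<lambda>n. X n) \<longlonglongrightarrow> (\<Sum>n. X (Suc n) - X n)"
      using summable_LIMSEQ[of "\<lambda>n. X (Suc n) - X n"] by (simp add: sum_lessThan_telescope X(3))
    then obtain x where x: "X \<longlonglongrightarrow> x" by blast
    have "x \<in> S"
      using closed_sequentially[OF S(2) _ x] X(1) by blast
    moreover have "f x = y"
    proof (rule LIMSEQ_unique)
      show "(\<lambda>n. f (X n)) \<longlonglongrightarrow> f x"
        using x by (rule f.tendsto)
      have "(\<lambda>n. norm y * (1 / 2) ^ n) \<longlonglongrightarrow> norm y * 0"
        by (intro tendsto_intros LIMSEQ_power_zero) simp
      then have "(\<lambda>n. norm y * (1 / 2) ^ n) \<longlonglongrightarrow> 0" by simp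
      then have "(\<lambda>n. y - f (X n)) \<longlonglongrightarrow> 0"
        by (rule Lim_null_comparison[rotated]) (use X(2) in \<open>auto simp: power_one_over\<close>)
      then have "(\<lambda>n. y - (y - f (X n))) \<longlonglongrightarrow> y - 0"
        by (intro tendsto_intros)
      then show "(\<lambda>n. f (X n)) \<longlonglongrightarrow> y" by simp
    qed
    moreover have "norm x \<le> 2 * K * norm y"
    proof (rule LIMSEQ_le_const2[OF tendsto_norm[OF x]])
      have bound: "norm (X n) \<le> 2 * K * norm y * (1 - 1 / 2 ^ n)" for n
      proof (induction n)
        case (Suc n)
        have "norm (X (Suc n)) \<le> norm (X n) + norm (X (Suc n) - X n)"
          using norm_triangle_ineq[of "X n" "X (Suc n) - X n"] by simp
        also have "\<dots> \<le> 2 * K * norm y * (1 - 1 / 2 ^ n) + K * norm y / 2 ^ n"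
          using Suc X(4) by (intro add_mono)
        also have "\<dots> = 2 * K * norm y * (1 - 1 / 2 ^ Suc n)"
          by (simp add: field_simps)
        finally show ?case .
      qed (simp add: X(3))
      have "norm (X n) \<le> 2 * K * norm y" for n
      proof -
        have "2 * K * norm y * (1 - 1 / 2 ^ n) \<le> 2 * K * norm y * 1"
          using K(1) by (intro mult_left_mono) auto
        with bound[of n] show ?thesis by simp
      qed
      then show "\<exists>N. \<forall>n\<ge>N. norm (X n) \<le> 2 * K * norm y" by blast
    qed
    ultimately show ?thesis by (intro bexI[of _ x] conjI)
  qed
  then have "\<forall>y\<in>f ` S. \<exists>x\<in>S. f x = y \<and> norm x \<le> 2 * K * norm y" by (rule ballI)
  moreover have "2 * K > 0" using K(1) by simp
  ultimately show thesis by (rule that[rotated])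
qed

section \<open>Maximal ideals\<close>

text \<open>The library syntax for composition binds weaker than \<open>+\<close>.\<close>

notation blinfun_compose (infixl "\<cdot>" 70)

lemma bounded_ops_scaleC: "T \<in> bounded_ops \<Longrightarrow> T (c *\<^sub>C x) = c *\<^sub>C T x"
  by (simp add: bounded_ops_def Vector_Spaces.linear_iff)

lemma scaleC_blinfun_compose: "(c *\<^sub>C S) \<cdot> T = c *\<^sub>C (S \<cdot> T)"
  by (rule blinfun_eqI) (simp add: scaleC_blinfun.rep_eq)

lemma blinfun_compose_scaleC: "S \<in> bounded_ops \<Longrightarrow> S \<cdot> (c *\<^sub>C T) = c *\<^sub>C (S \<cdot> T)"
  by (rule blinfun_eqI) (simp add: scaleC_blinfun.rep_eq bounded_ops_scaleC)

lemma csubspace_imp_subspace: "csubspace S \<Longrightarrow> subspace S"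
  by (simp add: complex_vector.subspace_def subspace_def flip: scaleC_of_real)

lemmas blinfun_compose_simps =
  bounded_bilinear.add_left[OF bounded_bilinear_blinfun_compose]
  bounded_bilinear.add_right[OF bounded_bilinear_blinfun_compose]
  bounded_bilinear.diff_left[OF bounded_bilinear_blinfun_compose]
  bounded_bilinear.diff_right[OF bounded_bilinear_blinfun_compose]
  bounded_bilinear.minus_left[OF bounded_bilinear_blinfun_compose]
  bounded_bilinear.minus_right[OF bounded_bilinear_blinfun_compose]
  bounded_bilinear.scaleR_left[OF bounded_bilinear_blinfun_compose]
  bounded_bilinear.scaleR_right[OF bounded_bilinear_blinfun_compose]

lemma blinfun_compose_id [simp]: "T \<cdot> id_blinfun = T" "id_blinfun \<cdot> T = T"
  by (rule blinfun_eqI; simp)+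

lemma blinfun_compose_assoc: "(S \<cdot> T) \<cdot> U = S \<cdot> (T \<cdot> U)"
  by (rule blinfun_eqI) simp

lemma norm_id_blinfun_le: "norm (id_blinfun :: 'a :: real_normed_vector \<Rightarrow>\<^sub>L 'a) \<le> 1"
  by (rule norm_blinfun_bound) auto

section \<open>Abelian unital norm closed algebras of operators\<close>

locale unital_op_algebra =
  fixes A :: "('a :: complex_banach \<Rightarrow>\<^sub>L 'a) set"
  assumes subalgebra: "subalgebra A" and abelian: "abelian A" and unital: "unital A"
    and closed: "closed A"
begin

abbreviation one :: "'a \<Rightarrow>\<^sub>L 'a" ("\<one>") where "\<one> \<equiv> id_blinfun"

lemma subspace_A: "csubspace A"
  using subalgebra by (simp add: subalgebra_def)

lemma A_bounded_ops: "a \<in> A \<Longrightarrow> a \<in> bounded_ops"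
  using subalgebra by (auto simp: subalgebra_def)

lemma mem_A [simp]:
  "\<one> \<in> A" "0 \<in> A"
  "a \<in> A \<Longrightarrow> b \<in> A \<Longrightarrow> a + b \<in> A"
  "a \<in> A \<Longrightarrow> b \<in> A \<Longrightarrow> a - b \<in> A"
  "a \<in> A \<Longrightarrow> c *\<^sub>C a \<in> A"
  "a \<in> A \<Longrightarrow> r *\<^sub>R a \<in> A"
  "a \<in> A \<Longrightarrow> b \<in> A \<Longrightarrow> a \<cdot> b \<in> A"
  using unital subspace_A subalgebra
  by (auto simp: unital_def subalgebra_def complex_vector.subspace_add
      complex_vector.subspace_diff complex_vector.subspace_scale complex_vector.subspace_0
      simp flip: scaleC_of_real)

lemma commute: "a \<in> A \<Longrightarrow> b \<in> A \<Longrightarrow> a \<cdot> b = b \<cdot> a"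
  using abelian by (auto simp: abelian_def)

text \<open>The Neumann series in fixed point form: the inverse of \<open>m\<close> is the fixed
  point of \<open>v \<mapsto> \<one> + v \<cdot> (\<one> - m)\<close>, a contraction of the complete
  set \<open>A\<close>.\<close>

lemma inverse_near_one:
  assumes m: "m \<in> A" "norm (\<one> - m) < 1"
  obtains v where "v \<in> A" "v \<cdot> m = \<one>"
proof -
  define f where "f v = \<one> + v \<cdot> (\<one> - m)" for v
  have "\<exists>!v\<in>A. f v = v"
  proof (rule Banach_fix)
    show "complete A" using closed by (simp add: complete_eq_closed)
    show "A \<noteq> {}" using mem_A(1) by blast
    show "f ` A \<subseteq> A" using m(1) by (auto simp: f_def)
    show "dist (f v) (f w) \<le> norm (\<one> - m) * dist v w" for v w
      using norm_blinfun_compose[of "v - w" "\<one> - m"]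
      by (simp add: f_def dist_norm mult.commute flip: bounded_bilinear.diff_left[OF bounded_bilinear_blinfun_compose])
  qed (use m in auto)
  then obtain v where v: "v \<in> A" "f v = v" by blast
  have "v \<cdot> m = \<one>"
    using v(2) by (simp add: f_def blinfun_compose_simps algebra_simps)
  with v(1) show thesis by (rule that)
qed

end

section \<open>Units modulo a maximal ideal and closedness of the ideal\<close>

locale op_algebra_maximal_ideal = unital_op_algebra +
  fixes M
  assumes maximal: "maximal_ideal A M"
begin

lemma ideal: "algebra_ideal A M"
  using maximal by (simp add: maximal_ideal_def)

lemma M_subset: "m \<in> M \<Longrightarrow> m \<in> A"
  using ideal by (auto simp: algebra_ideal_def)

lemma M_csubspace: "csubspace M"
  using ideal by (simp add: algebra_ideal_def)

lemma mem_M [simp]: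
  "0 \<in> M"
  "m \<in> M \<Longrightarrow> n \<in> M \<Longrightarrow> m + n \<in> M"
  "m \<in> M \<Longrightarrow> n \<in> M \<Longrightarrow> m - n \<in> M"
  "m \<in> M \<Longrightarrow> c *\<^sub>C m \<in> M"
  "m \<in> M \<Longrightarrow> r *\<^sub>R m \<in> M"
  "m \<in> M \<Longrightarrow> a \<in> A \<Longrightarrow> a \<cdot> m \<in> M"
  "m \<in> M \<Longrightarrow> a \<in> A \<Longrightarrow> m \<cdot> a \<in> M"
  using M_csubspace ideal
  by (auto simp: algebra_ideal_def complex_vector.subspace_add
      complex_vector.subspace_diff complex_vector.subspace_scale complex_vector.subspace_0
      simp flip: scaleC_of_real)

lemma one_notin: "\<one> \<notin> M"
proof
  assume "\<one> \<in> M"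
  then have "a \<in> M" if "a \<in> A" for a
    using mem_M(6)[OF _ that, of \<one>] by simp
  with M_subset maximal show False
    by (auto simp: maximal_ideal_def)
qed

text \<open>An element of \<open>M\<close> closer to \<open>\<one>\<close> would be invertible in
  \<open>A\<close> and force \<open>\<one> \<in> M\<close>.\<close>

lemma norm_one_minus_ge: "m \<in> M \<Longrightarrow> norm (\<one> - m) \<ge> 1"
  using inverse_near_one[of m] M_subset[of m] one_notin mem_M(6)[of m]
  by (metis not_less)

lemma inverse_mod:
  assumes a: "a \<in> A" "a \<notin> M"
  obtains b where "b \<in> A" "b \<cdot> a - \<one> \<in> M"
proof -
  \<comment> \<open>The ideal generated by \<open>M\<close> and \<open>a\<close>; by maximality it
    is all of \<open>A\<close> and so contains \<open>\<one>\<close>.\<close>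
  define J where "J = {m + b \<cdot> a | m b. m \<in> M \<and> b \<in> A}"
  have J: "m + b \<cdot> a \<in> J" if "m \<in> M" "b \<in> A" for m b
    using that by (auto simp: J_def)
  have "algebra_ideal A J"
    unfolding algebra_ideal_def
  proof (intro conjI ballI)
    show "J \<subseteq> A" using a(1) by (auto simp: J_def dest: M_subset)
    show "csubspace J"
    proof (rule complex_vector.subspaceI)
      show "0 \<in> J" using J[of 0 0] by simp
      show "x + y \<in> J" if xy: "x \<in> J" "y \<in> J" for x y
      proof -
        obtain m b n c where "x = m + b \<cdot> a" "m \<in> M" "b \<in> A"
          and "y = n + c \<cdot> a" "n \<in> M" "c \<in> A"
          using xy unfolding J_def by blast
        then show ?thesis
          using J[of "m + n" "b + c"] by (simp add: blinfun_compose_simps algebra_simps)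
      qed
      show "k *\<^sub>C x \<in> J" if x: "x \<in> J" for k x
      proof -
        obtain m b where "x = m + b \<cdot> a" "m \<in> M" "b \<in> A"
          using x by (auto simp: J_def)
        then show ?thesis
          using J[of "k *\<^sub>C m" "k *\<^sub>C b"] by (simp add: scaleC_blinfun_compose scaleC_add_right)
      qed
    qed
    fix c x assume "c \<in> A" "x \<in> J"
    then obtain m b where x: "x = m + b \<cdot> a" "m \<in> M" "b \<in> A"
      by (auto simp: J_def)
    with \<open>c \<in> A\<close> show "c \<cdot> x \<in> J"
      using J[of "c \<cdot> m" "c \<cdot> b"] by (simp add: blinfun_compose_simps blinfun_compose_assoc)
    moreover have "x \<in> A" using x a by (auto dest: M_subset)
    ultimately show "x \<cdot> c \<in> J"
      using commute[OF \<open>c \<in> A\<close>, of x] by simp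
  qed
  moreover have "M \<subseteq> J" using J[of _ 0] by auto
  moreover have "a \<in> J" using J[of 0 \<one>] by simp
  ultimately have "J = A"
    using maximal a(2) by (auto simp: maximal_ideal_def)
  then have "\<one> \<in> J" by simp
  then obtain m b where m: "\<one> = m + b \<cdot> a" "m \<in> M" "b \<in> A"
    by (auto simp: J_def)
  have "b \<cdot> a - \<one> = 0 - m" by (simp add: m(1))
  also have "\<dots> \<in> M" using m(2) by (intro mem_M)
  finally show thesis using m(3) that by blast
qed

text \<open>A limit point \<open>x\<close> outside \<open>M\<close> would have an inverse
  \<open>b\<close> modulo \<open>M\<close>, and approximating \<open>x\<close> from \<open>M\<close>
  would bring elements of \<open>M\<close> too close to \<open>\<one>\<close>.\<close>

lemma closed_M: "closed M"
proof -
  have M: "subspace M" using M_csubspace by (rule csubspace_imp_subspace)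
  have "closure M \<subseteq> M"
  proof
    fix x assume x: "x \<in> closure M"
    have "closure M \<subseteq> A" using closed M_subset by (intro closure_minimal) auto
    with x have xA: "x \<in> A" by blast
    show "x \<in> M"
    proof (rule ccontr)
      assume "x \<notin> M"
      with xA obtain b where b: "b \<in> A" "b \<cdot> x - \<one> \<in> M" by (rule inverse_mod)
      obtain m where m: "m \<in> M" "norm (m - x) < 1 / (norm b + 1)"
        using x unfolding closure_approachable dist_norm
        by (metis add_nonneg_pos norm_ge_zero zero_less_divide_1_iff zero_less_one)
      \<comment> \<open>The subtracted element lies in \<open>M\<close> and differs from
        \<open>\<one>\<close> exactly by \<open>b \<cdot> (m - x)\<close> up to sign.\<close>
      have "1 \<le> norm (\<one> - (b \<cdot> m - (b \<cdot> x - \<one>)))"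
        using m b by (intro norm_one_minus_ge) auto
      also have "\<dots> = norm (b \<cdot> (m - x))"
        by (simp add: blinfun_compose_simps norm_minus_commute)
      also have "\<dots> \<le> norm b * norm (m - x)" by (rule norm_blinfun_compose)
      also have "\<dots> \<le> norm b * (1 / (norm b + 1))"
        using m by (intro mult_left_mono) auto
      also have "\<dots> < 1" by (simp add: divide_less_eq add_nonneg_pos)
      finally show False by simp
    qed
  qed
  then show ?thesis using closure_subset_eq by blast
qed

end

section \<open>Gelfand-Mazur theorem\<close>

lemma power_two_power_Suc: "x ^ 2 ^ Suc m = x ^ 2 ^ m * (x ^ 2 ^ m :: 'b :: monoid_mult)"
  by (simp add: mult_2 power_add)

section \<open>The quotient norm of \<open>A / M\<close>\<close>

context op_algebra_maximal_ideal
begin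

abbreviation qnorm :: "('a \<Rightarrow>\<^sub>L 'a) \<Rightarrow> real" where "qnorm x \<equiv> infdist x M"

lemma qnorm_le: "n \<in> M \<Longrightarrow> qnorm x \<le> norm (x - n)"
  using infdist_le[of n M x] by (simp add: dist_norm)

text \<open>Greatest lower bound property of the quotient norm with a factor built in, so that
  estimates for sums and products can be proved by freeing one representative at a time.\<close>

lemma qnorm_geI:
  assumes "c \<ge> 0" and "\<And>n. n \<in> M \<Longrightarrow> k \<le> c * norm (x - n)"
  shows "k \<le> c * qnorm x"
proof (cases "c = 0")
  case True
  then show ?thesis using assms(2)[of 0] by simp
next
  case False
  have "M \<noteq> {}" using mem_M(1) by blast
  moreover have "k / c \<le> dist x n" if "n \<in> M" for n
    using assms(1) assms(2)[OF that] False by (simp add: dist_norm field_simps)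
  ultimately have "k / c \<le> qnorm x"
    by (auto simp: infdist_notempty intro!: cINF_greatest)
  then show ?thesis using False assms(1) by (simp add: field_simps)
qed

lemma qnorm_one: "qnorm \<one> = 1"
proof (rule antisym)
  show "qnorm \<one> \<le> 1"
    using qnorm_le[of 0 \<one>] norm_id_blinfun_le[where 'a = 'a] by simp
  show "1 \<le> qnorm \<one>"
    using qnorm_geI[of 1 1 \<one>] norm_one_minus_ge by simp
qed

lemma qnorm_cong:
  assumes "x - y \<in> M"
  shows "qnorm x = qnorm y"
proof -
  have "qnorm x \<le> qnorm y" if "x - y \<in> M" for x y
  proof -
    have "qnorm x \<le> 1 * qnorm y"
    proof (rule qnorm_geI)
      fix n assume "n \<in> M"
      then have "n + (x - y) \<in> M" using that by (rule mem_M)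
      from qnorm_le[OF this, of x] show "qnorm x \<le> 1 * norm (y - n)"
        by (simp add: algebra_simps)
    qed simp
    then show ?thesis by simp
  qed
  moreover have "y - x \<in> M"
    using mem_M(3)[OF mem_M(1) assms] by simp
  ultimately show ?thesis using assms by (intro antisym)
qed

lemma qnorm_add: "qnorm (x + y) \<le> qnorm x + qnorm y"
proof -
  have "qnorm (x + y) - norm (x - m) \<le> 1 * qnorm y" if "m \<in> M" for m
  proof (rule qnorm_geI)
    fix n assume "n \<in> M"
    then have "qnorm (x + y) \<le> norm (x + y - (m + n))"
      using that by (intro qnorm_le mem_M)
    also have "\<dots> = norm ((x - m) + (y - n))" by (simp add: algebra_simps)
    also have "\<dots> \<le> norm (x - m) + norm (y - n)" by (rule norm_triangle_ineq)
    finally show "qnorm (x + y) - norm (x - m) \<le> 1 * norm (y - n)" by simp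
  qed simp
  then have "qnorm (x + y) - qnorm y \<le> 1 * qnorm x"
    by (intro qnorm_geI) (simp_all add: algebra_simps)
  then show ?thesis by simp
qed

lemma qnorm_scaleC: "qnorm (c *\<^sub>C x) = cmod c * qnorm x"
proof -
  have le: "qnorm (c *\<^sub>C x) \<le> cmod c * qnorm x" for c x
  proof (rule qnorm_geI)
    fix n assume "n \<in> M"
    then show "qnorm (c *\<^sub>C x) \<le> cmod c * norm (x - n)"
      using qnorm_le[of "c *\<^sub>C n" "c *\<^sub>C x"]
      by (simp flip: norm_scaleC complex_vector.scale_right_diff_distrib)
  qed simp
  have "cmod c * qnorm x \<le> qnorm (c *\<^sub>C x)" if "c \<noteq> 0"
    using mult_left_mono[OF le[of "inverse c" "c *\<^sub>C x"], of "cmod c"] that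
    by (simp add: scaleC_scaleC norm_inverse flip: mult.assoc)
  with le[of c x] show ?thesis
    by (cases "c = 0") (auto intro: antisym)
qed

lemma qnorm_minus: "qnorm (- x) = qnorm x"
  using qnorm_scaleC[of "-1" x] by simp

lemma qnorm_diff: "qnorm (x - y) \<le> qnorm x + qnorm y"
  using qnorm_add[of x "- y"] by (simp add: qnorm_minus)

lemma qnorm_mult:
  assumes "x \<in> A" "y \<in> A"
  shows "qnorm (x \<cdot> y) \<le> qnorm x * qnorm y"
proof -
  have "qnorm (x \<cdot> y) \<le> norm (x - m) * qnorm y" if m: "m \<in> M" for m
  proof (rule qnorm_geI)
    fix n assume n: "n \<in> M"
    \<comment> \<open>The element subtracted from \<open>x \<cdot> y\<close> is chosen so that what
      remains is the product of the representatives \<open>x - m\<close> and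
      \<open>y - n\<close>.\<close>
    have "qnorm (x \<cdot> y) \<le> norm (x \<cdot> y - (m \<cdot> (y - n) + x \<cdot> n))"
      using m n assms M_subset by (intro qnorm_le mem_M) auto
    also have "x \<cdot> y - (m \<cdot> (y - n) + x \<cdot> n) = (x - m) \<cdot> (y - n)"
      by (simp add: blinfun_compose_simps)
    also have "norm \<dots> \<le> norm (x - m) * norm (y - n)" by (rule norm_blinfun_compose)
    finally show "qnorm (x \<cdot> y) \<le> norm (x - m) * norm (y - n)" .
  qed simp
  then have "qnorm (x \<cdot> y) \<le> qnorm y * qnorm x"
    by (intro qnorm_geI) (simp_all add: mult.commute infdist_nonneg)
  then show ?thesis by (simp add: mult.commute)
qed

text \<open>\<open>qnorm\<close> is the norm of the quotient \<open>A / M\<close>, which is not available as a type. The following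
  is Rickart's proof of the Gelfand-Mazur theorem, which avoids both Liouville's theorem and the
  Hahn-Banach theorem: if \<open>\<one> - w a\<close> were invertible modulo \<open>M\<close> for all \<open>w\<close>, with inverse \<open>g w\<close>, then the
  averages of \<open>g\<close> over \<open>w\<close> times the \<open>2\<^sup>m\<close>-th roots of unity are inverses of \<open>\<one> - (w a) ^ 2\<^sup>m\<close>, and
  they inherit the Lipschitz constant of \<open>g\<close>. This makes \<open>a\<close> quasinilpotent modulo \<open>M\<close>,
  although it is invertible modulo \<open>M\<close>.\<close>

definition resolvent :: "('a \<Rightarrow>\<^sub>L 'a) \<Rightarrow> (complex \<Rightarrow> 'a \<Rightarrow>\<^sub>L 'a) \<Rightarrow> bool"
  where "resolvent a g \<longleftrightarrow> (\<forall>w. g w \<in> A \<and> g w \<cdot> (\<one> - w *\<^sub>C a) - \<one> \<in> M)"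

text \<open>If \<open>\<one> - w *\<^sub>C a\<close> were in \<open>M\<close>, then
  \<open>w = 0\<close> would put \<open>\<one>\<close> in \<open>M\<close>, and otherwise
  \<open>a\<close> would be congruent to the scalar \<open>inverse w\<close>.\<close>

lemma resolvent_exists:
  assumes a: "a \<in> A" and notin: "\<And>l. a - l *\<^sub>C \<one> \<notin> M"
  shows "\<exists>g. resolvent a g"
proof -
  have "\<exists>b. b \<in> A \<and> b \<cdot> (\<one> - w *\<^sub>C a) - \<one> \<in> M" for w
  proof -
    have "\<one> - w *\<^sub>C a \<notin> M"
    proof
      assume *: "\<one> - w *\<^sub>C a \<in> M"
      show False
      proof (cases "w = 0")
        case True
        with * one_notin show False by simp
      next
        case False
        have "(- inverse w) *\<^sub>C (\<one> - w *\<^sub>C a) \<in> M" using * by (rule mem_M)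
        also have "(- inverse w) *\<^sub>C (\<one> - w *\<^sub>C a) = a - inverse w *\<^sub>C \<one>"
          using False by (simp add: complex_vector.scale_right_diff_distrib)
        finally show False using notin by blast
      qed
    qed
    then show ?thesis
      using inverse_mod[of "\<one> - w *\<^sub>C a"] a by (metis mem_A(1,4,5))
  qed
  then show ?thesis unfolding resolvent_def by metis
qed

lemma resolvent_identity:
  assumes a: "a \<in> A" and g: "resolvent a g"
  shows "qnorm (g w - g v) \<le> cmod (w - v) * (qnorm (g w) * qnorm (g v) * qnorm a)"
proof -
  have gA: "g w \<in> A" "g v \<in> A" using g by (auto simp: resolvent_def)
  let ?X = "\<lambda>w. g w \<cdot> (\<one> - w *\<^sub>C a) - \<one>"
  have X: "?X w \<in> M" "?X v \<in> M" using g by (auto simp: resolvent_def)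
  \<comment> \<open>Multiplying each defining congruence by the other resolvent value and
    subtracting gives the first resolvent identity modulo \<open>M\<close>.\<close>
  have "g v \<cdot> ?X w - g w \<cdot> ?X v \<in> M"
    by (rule mem_M(3)[OF mem_M(6)[OF X(1) gA(2)] mem_M(6)[OF X(2) gA(1)]])
  also have "g v \<cdot> ?X w - g w \<cdot> ?X v = (g w - g v) - (w - v) *\<^sub>C (g w \<cdot> g v \<cdot> a)"
    using gA commute[OF gA] A_bounded_ops
    by (simp add: blinfun_compose_simps blinfun_compose_scaleC
        complex_vector.scale_left_diff_distrib flip: blinfun_compose_assoc)
  finally have "qnorm (g w - g v) = cmod (w - v) * qnorm (g w \<cdot> g v \<cdot> a)"
    by (simp add: qnorm_cong qnorm_scaleC)
  also have "\<dots> \<le> cmod (w - v) * (qnorm (g w \<cdot> g v) * qnorm a)"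
    using gA a by (intro mult_left_mono qnorm_mult) auto
  also have "\<dots> \<le> cmod (w - v) * (qnorm (g w) * qnorm (g v) * qnorm a)"
    using gA a by (intro mult_left_mono mult_right_mono qnorm_mult infdist_nonneg) auto
  finally show ?thesis .
qed

text \<open>The resolvent identity becomes a Lipschitz estimate once \<open>qnorm (g w)\<close> is
  bounded on the disc.\<close>

lemma resolvent_lipschitz:
  assumes a: "a \<in> A" and g: "resolvent a g"
  shows "\<exists>C. \<forall>w\<in>cball 0 R. \<forall>v\<in>cball 0 R. qnorm (g w - g v) \<le> C * cmod (w - v)"
proof -
  define h where "h w = qnorm (g w)" for w
  have gA: "g w \<in> A" for w using g by (auto simp: resolvent_def)
  \<comment> \<open>\<open>g w\<close> is invertible modulo \<open>M\<close>, so its quotient norm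
    cannot vanish.\<close>
  have h: "h w > 0" for w
  proof (rule ccontr)
    assume "\<not> h w > 0"
    then have "h w = 0" using infdist_nonneg[of "g w" M] by (simp add: h_def)
    have "1 = qnorm (g w \<cdot> (\<one> - w *\<^sub>C a))"
      using g qnorm_cong[of "g w \<cdot> (\<one> - w *\<^sub>C a)" \<one>] by (simp add: resolvent_def qnorm_one)
    also have "\<dots> \<le> h w * qnorm (\<one> - w *\<^sub>C a)"
      unfolding h_def using gA a by (intro qnorm_mult) auto
    finally show False using \<open>h w = 0\<close> by simp
  qed
  \<comment> \<open>Dividing the resolvent identity by \<open>h w * h v\<close> removes the unknown
    values of \<open>h\<close> from the bound.\<close>
  have inv_le: "inverse (h v) - inverse (h w) \<le> qnorm a * cmod (w - v)" for w v
  proof -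
    have "h w \<le> h v + qnorm (g w - g v)"
      using qnorm_add[of "g v" "g w - g v"] by (simp add: h_def)
    also have "\<dots> \<le> h v + cmod (w - v) * (h w * h v * qnorm a)"
      using resolvent_identity[OF a g] by (simp add: h_def)
    finally show ?thesis
      using h[of w] h[of v] by (simp add: field_simps)
  qed
  \<comment> \<open>The reciprocal of \<open>h\<close> is continuous and positive, hence \<open>h\<close> is bounded on discs.\<close>
  have "(qnorm a)-lipschitz_on (cball 0 R) (\<lambda>w. inverse (h w))"
  proof (rule lipschitz_onI)
    show "dist (inverse (h x)) (inverse (h y)) \<le> qnorm a * dist x y" for x y
      using inv_le[of x y] inv_le[of y x]
      by (simp add: dist_norm norm_minus_commute abs_le_iff)
  qed (rule infdist_nonneg)
  then have cont: "continuous_on (cball 0 R) (\<lambda>w. inverse (h w))"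
    by (rule lipschitz_on_continuous_on)
  have "continuous_on (cball 0 R) (\<lambda>w. inverse (inverse (h w)))"
    using h by (intro continuous_on_inverse[OF cont] ballI) (metis inverse_nonzero_iff_nonzero less_irrefl)
  then have "bounded (h ` cball 0 R)"
    by (auto intro!: compact_imp_bounded compact_continuous_image)
  then obtain K where "\<forall>x\<in>h ` cball 0 R. norm x \<le> K"
    unfolding bounded_iff by blast
  then have "norm (h w) \<le> K" if "w \<in> cball 0 R" for w
    using that by blast
  then have K: "h w \<le> K" if "w \<in> cball 0 R" for w
    using that by (metis abs_ge_self order_trans real_norm_def)
  have "qnorm (g w - g v) \<le> (K * K * qnorm a) * cmod (w - v)"
    if "w \<in> cball 0 R" "v \<in> cball 0 R" for w v
  proof -
    have "qnorm (g w - g v) \<le> cmod (w - v) * (h w * h v * qnorm a)"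
      unfolding h_def by (rule resolvent_identity[OF a g])
    also have "\<dots> \<le> cmod (w - v) * (K * K * qnorm a)"
      using K that h order_trans[OF less_imp_le[OF h] K]
      by (intro mult_left_mono mult_right_mono mult_mono) (auto simp: infdist_nonneg less_imp_le)
    finally show ?thesis by (simp add: mult.commute)
  qed
  then show ?thesis by blast
qed

section \<open>Powers \<open>a ^ 2 ^ m\<close>, written \<open>iter_square m a\<close>, and averages
  of the resolvent\<close>

primrec iter_square :: "nat \<Rightarrow> ('a \<Rightarrow>\<^sub>L 'a) \<Rightarrow> 'a \<Rightarrow>\<^sub>L 'a"
  where "iter_square 0 a = a"
  | "iter_square (Suc m) a = iter_square m a \<cdot> iter_square m a"

lemma iter_square_in: "a \<in> A \<Longrightarrow> iter_square m a \<in> A"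
  by (induction m) auto

text \<open>What matters is that \<open>C\<close> and \<open>R\<close> do not depend on
  \<open>m\<close>: multiplication by a number of modulus 1 preserves the disc and distances, so
  averaging does not worsen the constant.\<close>

lemma resolvent_average:
  assumes a: "a \<in> A" and g: "resolvent a g"
    and lip: "\<And>w v. w \<in> cball 0 R \<Longrightarrow> v \<in> cball 0 R \<Longrightarrow> qnorm (g w - g v) \<le> C * cmod (w - v)"
  shows "\<exists>F. (\<forall>w. F w \<in> A \<and> F w \<cdot> (\<one> - w ^ 2 ^ m *\<^sub>C iter_square m a) - \<one> \<in> M) \<and>
    (\<forall>w\<in>cball 0 R. \<forall>v\<in>cball 0 R. qnorm (F w - F v) \<le> C * cmod (w - v))"
proof (induction m)
  case 0
  show ?case using g lip by (intro exI[of _ g]) (auto simp: resolvent_def)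
next
  case (Suc m)
  then obtain F where "\<forall>w. F w \<in> A \<and> F w \<cdot> (\<one> - w ^ 2 ^ m *\<^sub>C iter_square m a) - \<one> \<in> M"
    and "\<forall>w\<in>cball 0 R. \<forall>v\<in>cball 0 R. qnorm (F w - F v) \<le> C * cmod (w - v)"
    by (elim exE conjE) (rule that)
  then have F: "\<And>w. F w \<in> A" "\<And>w. F w \<cdot> (\<one> - w ^ 2 ^ m *\<^sub>C iter_square m a) - \<one> \<in> M"
    and FL: "\<And>w v. w \<in> cball 0 R \<Longrightarrow> v \<in> cball 0 R \<Longrightarrow> qnorm (F w - F v) \<le> C * cmod (w - v)"
    by blast+
  \<comment> \<open>With \<open>u = w ^ 2\<^sup>m a\<^sub>m\<close>, where \<open>a\<^sub>m = iter_square m a\<close>, replacing \<open>w\<close> by \<open>z w\<close> turns \<open>u\<close> into \<open>- u\<close>;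
    and the mean of \<open>1 / (1 - u)\<close> and \<open>1 / (1 + u)\<close> is \<open>1 / (1 - u\<^sup>2)\<close>.\<close>
  define z where "z = cis (pi / 2 ^ m)"
  have "z ^ 2 ^ m = cis (real (2 ^ m) * (pi / 2 ^ m))"
    unfolding z_def by (rule Complex.DeMoivre)
  also have "real (2 ^ m) * (pi / 2 ^ m) = pi" by simp
  finally have z: "z ^ 2 ^ m = -1" "cmod z = 1"
    by (simp_all add: z_def)
  define G where "G w = (1 / 2) *\<^sub>R (F w + F (z * w))" for w
  have "G w \<in> A" for w
    using F(1) by (simp add: G_def)
  moreover have "G w \<cdot> (\<one> - w ^ 2 ^ Suc m *\<^sub>C iter_square (Suc m) a) - \<one> \<in> M" for w
  proof -
    define u where "u = w ^ 2 ^ m *\<^sub>C iter_square m a"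
    have uA: "u \<in> A" using a by (simp add: u_def iter_square_in)
    have 1: "F w \<cdot> (\<one> - u) - \<one> \<in> M"
      using F(2)[of w] by (simp add: u_def)
    have 2: "F (z * w) \<cdot> (\<one> + u) - \<one> \<in> M"
      using F(2)[of "z * w"] by (simp add: u_def power_mult_distrib z)
    \<comment> \<open>Each congruence is multiplied by the other denominator, giving the common
      denominator \<open>(\<one> - u) \<cdot> (\<one> + u) = \<one> - u \<cdot> u\<close>.\<close>
    have "(1 / 2) *\<^sub>R ((F w \<cdot> (\<one> - u) - \<one>) \<cdot> (\<one> + u) + (F (z * w) \<cdot> (\<one> + u) - \<one>) \<cdot> (\<one> - u)) \<in> M"
      using 1 2 uA by (intro mem_M(2,5,7) mem_A) auto
    also have "(F w \<cdot> (\<one> - u) - \<one>) \<cdot> (\<one> + u) + (F (z * w) \<cdot> (\<one> + u) - \<one>) \<cdot> (\<one> - u)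
        = (F w + F (z * w)) \<cdot> (\<one> - u \<cdot> u) - (\<one> + \<one>)"
      by (simp add: blinfun_compose_simps blinfun_compose_assoc)
    also have "(1 / 2) *\<^sub>R \<dots> = G w \<cdot> (\<one> - u \<cdot> u) - (1 / 2) *\<^sub>R (\<one> + \<one>)"
      by (simp only: G_def blinfun_compose_simps scaleR_diff_right)
    also have "u \<cdot> u = w ^ 2 ^ Suc m *\<^sub>C iter_square (Suc m) a"
      using A_bounded_ops[OF iter_square_in[OF a]]
      by (simp add: u_def scaleC_blinfun_compose blinfun_compose_scaleC scaleC_scaleC
          power_two_power_Suc del: power_Suc)
    also have "(1 / 2) *\<^sub>R (\<one> + \<one>) = \<one>"
      by (simp flip: scaleR_2)
    finally show ?thesis .
  qed
  moreover have "qnorm (G w - G v) \<le> C * cmod (w - v)"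
    if "w \<in> cball 0 R" "v \<in> cball 0 R" for w v
  proof -
    have "qnorm (G w - G v) = (1 / 2) * qnorm ((F w - F v) + (F (z * w) - F (z * v)))"
      using qnorm_scaleC[of "of_real (1 / 2)" "(F w - F v) + (F (z * w) - F (z * v))"]
      unfolding scaleC_of_real by (simp add: G_def algebra_simps)
    also have "\<dots> \<le> (1 / 2) * (C * cmod (w - v) + C * cmod (z * w - z * v))"
      using that z(2)
      by (intro mult_left_mono order_trans[OF qnorm_add] add_mono FL) (auto simp: norm_mult)
    also have "cmod (z * w - z * v) = cmod (w - v)"
      using z(2) by (simp add: norm_mult flip: right_diff_distrib)
    finally show ?thesis by simp
  qed
  ultimately show ?case by blast
qed

text \<open>For \<open>s \<ge> 0\<close> this says that \<open>s a\<close> has spectral radius below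
  1 in \<open>A / M\<close>, expressed through powers with exponent \<open>2 ^ m\<close>
  only.\<close>

definition quasinilpotent_at :: "('a \<Rightarrow>\<^sub>L 'a) \<Rightarrow> real \<Rightarrow> bool"
  where "quasinilpotent_at a s \<longleftrightarrow> (\<exists>m. s ^ 2 ^ m * qnorm (iter_square m a) < 1)"

text \<open>Passing from \<open>m\<close> to \<open>Suc m\<close> at most squares the quantity, so
  once below 1 it tends to 0.\<close>

lemma quasinilpotent_at_small:
  assumes a: "a \<in> A" and s: "s \<ge> 0" "quasinilpotent_at a s" and e: "e > 0"
  shows "\<exists>m. s ^ 2 ^ m * qnorm (iter_square m a) < e"
proof -
  define t where "t m = s ^ 2 ^ m * qnorm (iter_square m a)" for m
  have t0: "t m \<ge> 0" for m
    using s(1) by (simp add: t_def infdist_nonneg)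
  have step: "t (Suc m) \<le> t m * t m" for m
  proof -
    have "t (Suc m) \<le> s ^ 2 ^ Suc m * (qnorm (iter_square m a) * qnorm (iter_square m a))"
      unfolding t_def using s(1) iter_square_in[OF a] by (auto intro!: mult_left_mono qnorm_mult)
    also have "\<dots> = t m * t m"
      by (simp add: t_def power_two_power_Suc algebra_simps del: power_Suc)
    finally show ?thesis .
  qed
  obtain m where m: "t m < 1" using s(2) by (auto simp: quasinilpotent_at_def t_def)
  have pow: "t (m + k) \<le> t m * t m ^ k" for k
  proof (induction k)
    case (Suc k)
    have le: "t (m + k) \<le> t m"
      using Suc m t0[of m] by (meson mult_left_le order_trans power_le_one less_imp_le)
    have "t (m + Suc k) \<le> t (m + k) * t (m + k)" using step by simp
    also have "\<dots> \<le> (t m * t m ^ k) * t m"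
      using Suc le t0 by (intro mult_mono) auto
    finally show ?case by (simp add: algebra_simps)
  qed simp
  obtain k where k: "t m ^ k < e"
    using real_arch_pow_inv[OF e m] by blast
  have "t (m + k) \<le> 1 * t m ^ k"
    using m t0[of m] by (intro order_trans[OF pow] mult_right_mono) auto
  with k show ?thesis unfolding t_def by (auto intro!: exI[of _ "m + k"])
qed

text \<open>The admissible step size depends on \<open>C\<close> only and not on \<open>s\<close>, so finitely many steps lead
  from \<open>0\<close> to \<open>R\<close>.\<close>

lemma quasinilpotent_at_step:
  assumes a: "a \<in> A" and g: "resolvent a g"
    and lip: "\<And>w v. w \<in> cball 0 R \<Longrightarrow> v \<in> cball 0 R \<Longrightarrow> qnorm (g w - g v) \<le> C * cmod (w - v)"
    and s: "s \<in> {0..R}" "s' \<in> {0..R}" "C * \<bar>s' - s\<bar> \<le> 1 / 10"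
    and qn: "quasinilpotent_at a s"
  shows "quasinilpotent_at a s'"
proof -
  \<comment> \<open>The constants fit together: 1/16 here gives distance at most 1/15 of
    \<open>F s\<close> from \<open>\<one>\<close>, the step adds 1/10 to make 1/6, and
    \<open>q \<le> 1 / 6 + q / 6\<close> then gives \<open>q \<le> 1 / 5 < 1\<close>.\<close>
  obtain m where m: "s ^ 2 ^ m * qnorm (iter_square m a) < 1 / 16"
    using quasinilpotent_at_small[OF a _ qn, of "1 / 16"] s(1) by auto
  obtain F where F: "\<And>w. F w \<in> A" "\<And>w. F w \<cdot> (\<one> - w ^ 2 ^ m *\<^sub>C iter_square m a) - \<one> \<in> M"
    and FL: "\<And>w v. w \<in> cball 0 R \<Longrightarrow> v \<in> cball 0 R \<Longrightarrow> qnorm (F w - F v) \<le> C * cmod (w - v)"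
    using resolvent_average[OF a g lip, where m = m] by blast
  define u where "u r = complex_of_real r ^ 2 ^ m *\<^sub>C iter_square m a" for r
  have uA: "u r \<in> A" for r using a by (simp add: u_def iter_square_in)
  have qu: "qnorm (u r) = r ^ 2 ^ m * qnorm (iter_square m a)" if "r \<ge> 0" for r
    using that by (simp add: u_def qnorm_scaleC norm_power)
  \<comment> \<open>\<open>F\<close> inverts \<open>\<one> - u\<close> modulo \<open>M\<close>, so
    \<open>F - \<one>\<close> is congruent to \<open>F \<cdot> u\<close>.\<close>
  have eq: "qnorm (F (of_real r) - \<one>) = qnorm (F (of_real r) \<cdot> u r)" for r
    using F(2)[of "of_real r"] by (intro qnorm_cong) (simp add: u_def blinfun_compose_simps algebra_simps)
  have "qnorm (F s - \<one>) \<le> qnorm (F s) * qnorm (u s)"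
    unfolding eq using F(1) uA by (rule qnorm_mult)
  also have "\<dots> \<le> (qnorm (F s - \<one>) + 1) * (1 / 16)"
    using m qu[of s] s(1) qnorm_add[of "F s - \<one>" \<one>]
    by (intro mult_mono) (auto simp: qnorm_one infdist_nonneg)
  finally have e: "qnorm (F s - \<one>) \<le> 1 / 15" by simp
  have "qnorm (F s' - \<one>) \<le> qnorm (F s' - F s) + qnorm (F s - \<one>)"
    using qnorm_add[of "F s' - F s" "F s - \<one>"] by simp
  also have "qnorm (F s' - F s) \<le> C * \<bar>s' - s\<bar>"
    using FL[of "of_real s'" "of_real s"] s(1,2) by (simp flip: of_real_diff)
  finally have e': "qnorm (F s' - \<one>) \<le> 1 / 6" using s(3) e by simp
  have "qnorm (u s') = qnorm (F s' \<cdot> u s' - (F s' - \<one>) \<cdot> u s')"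
    by (simp add: blinfun_compose_simps)
  also have "\<dots> \<le> qnorm (F s' \<cdot> u s') + qnorm ((F s' - \<one>) \<cdot> u s')"
    by (rule qnorm_diff)
  also have "\<dots> \<le> 1 / 6 + 1 / 6 * qnorm (u s')"
  proof (rule add_mono)
    show "qnorm (F s' \<cdot> u s') \<le> 1 / 6" using e' eq[of s'] by simp
    have "qnorm ((F s' - \<one>) \<cdot> u s') \<le> qnorm (F s' - \<one>) * qnorm (u s')"
      using F(1) uA by (intro qnorm_mult) auto
    also have "\<dots> \<le> 1 / 6 * qnorm (u s')"
      using e' by (intro mult_right_mono infdist_nonneg)
    finally show "qnorm ((F s' - \<one>) \<cdot> u s') \<le> 1 / 6 * qnorm (u s')" .
  qed
  finally have "qnorm (u s') < 1" by simp
  then show ?thesis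
    using qu[of s'] s(2) by (auto simp: quasinilpotent_at_def)
qed

lemma quasinilpotent_at_all:
  assumes a: "a \<in> A" and g: "resolvent a g" and R: "R \<ge> 0"
  shows "quasinilpotent_at a R"
proof -
  obtain C where lip: "\<And>w v. w \<in> cball 0 R \<Longrightarrow> v \<in> cball 0 R \<Longrightarrow> qnorm (g w - g v) \<le> C * cmod (w - v)"
    using resolvent_lipschitz[OF a g] by blast
  \<comment> \<open>The number of grid steps makes each step of length \<open>R / N\<close>
    admissible; \<open>\<bar>C\<bar>\<close> covers a negative \<open>C\<close>, and the successor
    keeps \<open>N\<close> positive.\<close>
  obtain N0 :: nat where "10 * \<bar>C\<bar> * R \<le> N0"
    using real_arch_simple by blast
  then have N: "Suc N0 > 0" "10 * \<bar>C\<bar> * R \<le> Suc N0" by simp_all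
  define N where "N = Suc N0"
  note N = N[folded N_def]
  have "quasinilpotent_at a (real k * R / N)" if "k \<le> N" for k
    using that
  proof (induction k)
    case 0
    show ?case by (auto simp: quasinilpotent_at_def intro!: exI[of _ 0])
  next
    case (Suc k)
    have le: "real j * R / N \<in> {0..R}" if "j \<le> N" for j
    proof -
      have "real j * R / N \<le> real N * R / N"
        using that R by (intro divide_right_mono mult_right_mono) auto
      also have "\<dots> = R" using N(1) by simp
      finally show ?thesis using R by simp
    qed
    have "real (Suc k) * R / N - real k * R / N = R / N"
      by (simp add: distrib_right add_divide_distrib)
    then have "C * \<bar>real (Suc k) * R / N - real k * R / N\<bar> = C * (R / N)"
      using R by simp
    also have "\<dots> \<le> \<bar>C\<bar> * (R / N)"
      using R by (intro mult_right_mono) auto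
    also have "\<dots> \<le> 1 / 10"
      using N by (simp add: pos_divide_le_eq)
    finally show ?case
      using Suc le[of k] le[of "Suc k"]
      by (intro quasinilpotent_at_step[OF a g lip _ _ _ Suc.IH]) auto
  qed
  from this[of N] N(1) show ?thesis by simp
qed

text \<open>Otherwise \<open>a\<close> has an inverse \<open>b\<close> modulo \<open>M\<close>, and
  quasinilpotency at the radius \<open>qnorm b\<close> contradicts
  \<open>1 \<le> qnorm b ^ 2 ^ m * qnorm (iter_square m a)\<close>.\<close>

theorem Gelfand_Mazur:
  assumes a: "a \<in> A"
  obtains l where "a - l *\<^sub>C \<one> \<in> M"
proof -
  have "\<exists>l. a - l *\<^sub>C \<one> \<in> M"
  proof (rule ccontr)
    assume *: "\<nexists>l. a - l *\<^sub>C \<one> \<in> M"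
    then obtain g where g: "resolvent a g"
      using resolvent_exists[OF a] by blast
    have "a \<notin> M" using * by (metis complex_vector.scale_zero_left diff_zero)
    with a obtain b where b: "b \<in> A" "b \<cdot> a - \<one> \<in> M" by (rule inverse_mod)
    have inv: "iter_square m b \<cdot> iter_square m a - \<one> \<in> M" for m
    proof (induction m)
      case (Suc m)
      let ?b = "iter_square m b" and ?a = "iter_square m a"
      have "?b \<cdot> (?b \<cdot> ?a - \<one>) \<cdot> ?a + (?b \<cdot> ?a - \<one>) \<in> M"
        using Suc a b(1) by (intro mem_M(2,6,7) iter_square_in)
      then show ?case by (simp add: blinfun_compose_simps blinfun_compose_assoc)
    qed (use b in simp)
    have pow: "qnorm (iter_square m b) \<le> qnorm b ^ 2 ^ m" for m
    proof (induction m)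
      case (Suc m)
      have "qnorm (iter_square (Suc m) b) \<le> qnorm (iter_square m b) * qnorm (iter_square m b)"
        using iter_square_in[OF b(1)] by (simp add: qnorm_mult)
      also have "\<dots> \<le> qnorm b ^ 2 ^ m * qnorm b ^ 2 ^ m"
        using Suc by (intro mult_mono) (auto simp: infdist_nonneg)
      finally show ?case by (simp add: power_two_power_Suc del: power_Suc)
    qed simp
    obtain m where m: "qnorm b ^ 2 ^ m * qnorm (iter_square m a) < 1"
      using quasinilpotent_at_all[OF a g infdist_nonneg] by (auto simp: quasinilpotent_at_def)
    have "1 = qnorm (iter_square m b \<cdot> iter_square m a)"
      using qnorm_cong[OF inv] by (simp add: qnorm_one)
    also have "\<dots> \<le> qnorm (iter_square m b) * qnorm (iter_square m a)"
      using a b by (intro qnorm_mult iter_square_in)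
    also have "\<dots> \<le> qnorm b ^ 2 ^ m * qnorm (iter_square m a)"
      using pow by (intro mult_right_mono infdist_nonneg)
    finally show False using m by simp
  qed
  with that show thesis by blast
qed

end

section \<open>Reflexivity\<close>

text \<open>The strong topology is the pullback of the product topology under
  \<open>blinfun_apply\<close>, so pointwise limits of sequences are limits in it. Closedness is
  relative to \<open>bounded_ops\<close>, hence the assumption on \<open>T\<close>.\<close>

lemma strongly_closed_sequentially:
  fixes L :: "('a :: complex_normed_vector \<Rightarrow>\<^sub>L 'a) set"
  assumes closed: "strongly_closed L" and l: "\<And>n. l n \<in> L"
    and T: "T \<in> bounded_ops" and lim: "\<And>x. (\<lambda>n. l n x) \<longlonglongrightarrow> T x"
  shows "T \<in> L"
proof -
  have "limitin (product_topology (\<lambda>_. euclidean) UNIV)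
      (\<lambda>n. blinfun_apply (l n)) (blinfun_apply T) sequentially"
    using lim by (simp add: limitin_componentwise)
  then have "(\<lambda>n. blinfun_apply (l n)) \<longlonglongrightarrow> blinfun_apply T"
    by (simp add: euclidean_product_topology)
  then have limit: "limitin strong_operator_topology l T sequentially"
    by (auto simp: limitin_def strong_operator_topology_def topspace_pullback_topology
        openin_pullback_topology tendsto_def)
  obtain K where K: "closedin strong_operator_topology K" "L = K \<inter> bounded_ops"
    using closed by (auto simp: strongly_closed_def closedin_subtopology)
  have "T \<in> K"
    by (rule limitin_closedin[OF limit K(1)]) (use l K(2) in auto)
  with K(2) T show ?thesis by blast
qed

text \<open>Open mapping for addition on \<open>U \<times> V\<close>: the sum being direct, the
  preimage of controlled norm can only be \<open>(u, v)\<close> itself.\<close>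

lemma direct_sum_components_bounded:
  fixes U V :: "'a::banach set"
  assumes U: "subspace U" "closed U" and V: "subspace V" "closed V"
    and sum: "{u + v | u v. u \<in> U \<and> v \<in> V} = UNIV" and int: "U \<inter> V = {0}"
  obtains C where
    "\<forall>u\<in>U. \<forall>v\<in>V. norm u \<le> C * norm (u + v) \<and> norm v \<le> C * norm (u + v)"
proof -
  let ?f = "\<lambda>p::'a \<times> 'a. fst p + snd p"
  have f: "bounded_linear ?f"
    by (intro bounded_linear_add bounded_linear_fst bounded_linear_snd)
  have subspace: "subspace (U \<times> V)" using U V by (simp add: subspace_Times)
  have closed: "closed (U \<times> V)" using U V by (simp add: closed_Times)
  have img: "?f ` (U \<times> V) = UNIV"
  proof -
    have "?f ` (U \<times> V) = {u + v | u v. u \<in> U \<and> v \<in> V}"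
      by (auto simp: image_def Bex_def)
    also note sum
    finally show ?thesis .
  qed
  have "closed (?f ` (U \<times> V))" unfolding img by simp
  with f subspace closed
  obtain C where "C > 0" and C: "\<forall>y\<in>?f ` (U \<times> V). \<exists>p\<in>U \<times> V. ?f p = y \<and> norm p \<le> C * norm y"
    by (rule open_mapping_closed_subspace)
  have le: "norm (u, v) \<le> C * norm (u + v)" if uv: "u \<in> U" "v \<in> V" for u v
  proof -
    have "\<exists>p\<in>U \<times> V. fst p + snd p = u + v \<and> norm p \<le> C * norm (u + v)"
      using C unfolding img by blast
    then obtain p where "p \<in> U \<times> V" "fst p + snd p = u + v" "norm p \<le> C * norm (u + v)"
      by blast
    then obtain u' v' where p: "u' \<in> U" "v' \<in> V" "u' + v' = u + v" "norm (u', v') \<le> C * norm (u + v)"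
      by (intro that[of "fst p" "snd p"]) auto
    have eq: "u - u' = v' - v" using p(3) by (simp add: algebra_simps)
    have "u - u' \<in> U" using uv p U by (intro subspace_diff)
    moreover have "u - u' \<in> V" unfolding eq using uv p V by (intro subspace_diff)
    ultimately have "u - u' = 0" using int by blast
    with eq have "u = u'" "v = v'" by simp_all
    with p(4) show ?thesis by simp
  qed
  have "norm u \<le> C * norm (u + v) \<and> norm v \<le> C * norm (u + v)" if uv: "u \<in> U" "v \<in> V" for u v
    using le[OF uv] norm_fst_le[of u v] norm_snd_le[of v u] by linarith
  then show thesis by (intro that[of C] ballI)
qed

section \<open>Orbits and annihilators of vectors\<close>

context unital_op_algebra
begin

lemma bounded_linear_eval: "bounded_linear (\<lambda>a. blinfun_apply a x)"
  by (rule blinfun.bounded_linear_left)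

lemma subspace_orbit: "csubspace L \<Longrightarrow> subspace (orbit L x)"
  unfolding orbit_def
  by (intro linear_subspace_image csubspace_imp_subspace
      bounded_linear.linear[OF blinfun.bounded_linear_left])

definition annihilator :: "'a \<Rightarrow> ('a \<Rightarrow>\<^sub>L 'a) set"
  where "annihilator x = {a \<in> A. a x = 0}"

lemma annihilator_ideal: "algebra_ideal A (annihilator x)"
proof -
  have "csubspace (annihilator x)"
    by (rule complex_vector.subspaceI)
      (auto simp: annihilator_def blinfun.add_left scaleC_blinfun.rep_eq)
  moreover have "b \<cdot> a \<in> annihilator x \<and> a \<cdot> b \<in> annihilator x"
    if "b \<in> A" "a \<in> annihilator x" for a b
  proof -
    have a: "a \<in> A" "a x = 0" using that(2) by (auto simp: annihilator_def)
    have "(a \<cdot> b) x = (b \<cdot> a) x" using commute[OF that(1) a(1)] by simp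
    then show ?thesis
      using that(1) a by (simp add: annihilator_def blinfun.zero_right)
  qed
  ultimately show ?thesis
    by (auto simp: algebra_ideal_def annihilator_def)
qed

lemma closed_annihilator: "closed (annihilator x)"
proof -
  have "annihilator x = A \<inter> (\<lambda>a. blinfun_apply a x) -` {0}"
    by (auto simp: annihilator_def)
  also have "closed \<dots>"
    using closed by (intro closed_Int closed_vimage linear_continuous_on[OF bounded_linear_eval]) auto
  finally show ?thesis .
qed

lemma orbit_orbit_subset:
  assumes "\<And>b. b \<in> A \<Longrightarrow> b \<cdot> a \<in> B"
  shows "orbit A (a x) \<subseteq> orbit B x"
  unfolding orbit_def using assms by (force simp flip: blinfun_apply_blinfun_compose)

end

context op_algebra_maximal_ideal
begin

text \<open>Evaluation at \<open>x\<close> is open onto its closed range and its kernel lies in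
  \<open>M\<close>. So when \<open>m x\<close> is near \<open>c x\<close>, a small \<open>d\<close>
  has the same value at \<open>x\<close> as \<open>c - m\<close>; then \<open>c - d\<close> is in
  \<open>M\<close> and close to \<open>c\<close>.\<close>

lemma mem_if_eval_in_closure:
  assumes orbit: "closed (orbit A x)" and ann: "annihilator x \<subseteq> M"
    and c: "c \<in> A" "c x \<in> closure (orbit M x)"
  shows "c \<in> M"
proof -
  obtain C where C: "C > 0"
    "\<forall>y\<in>(\<lambda>a. blinfun_apply a x) ` A. \<exists>d\<in>A. blinfun_apply d x = y \<and> norm d \<le> C * norm y"
    by (rule open_mapping_closed_subspace[OF bounded_linear_eval csubspace_imp_subspace[OF subspace_A]
          closed orbit[unfolded orbit_def]])
  have "c \<in> closure M"
    unfolding closure_approachable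
  proof (intro allI impI)
    fix e :: real assume e: "e > 0"
    obtain y where "y \<in> orbit M x" "dist y (c x) < e / C"
      using c(2) e C(1) unfolding closure_approachable by (metis divide_pos_pos)
    then obtain m where m: "m \<in> M" "norm (c x - m x) < e / C"
      by (auto simp: orbit_def dist_norm norm_minus_commute)
    have "(c - m) x \<in> orbit A x"
      unfolding orbit_def using c(1) M_subset[OF m(1)] by (intro imageI mem_A)
    then obtain d where d: "d \<in> A" "d x = (c - m) x" "norm d \<le> C * norm ((c - m) x)"
      using C(2) unfolding orbit_def by blast
    have "c - m - d \<in> annihilator x"
      using c(1) M_subset[OF m(1)] d(1,2) by (simp add: annihilator_def blinfun.diff_left)
    with ann have "c - m - d \<in> M" by blast
    from mem_M(2)[OF this m(1)] have "c - d \<in> M" by simp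
    moreover have "dist (c - d) c < e"
      using d(3) m(2) C(1) by (simp add: dist_norm blinfun.diff_left pos_less_divide_eq mult.commute)
    ultimately show "\<exists>y\<in>M. dist y c < e" by blast
  qed
  then show ?thesis using closed_M by simp
qed

end

section \<open>Commutation with \<open>A\<close> and the reflexivity argument\<close>

context unital_op_algebra
begin

text \<open>Locality is used at three vectors: \<open>x\<close> gives \<open>t\<close>,
  \<open>a x\<close> gives \<open>b\<close>, and \<open>(a - l *\<^sub>C \<one>) x\<close> relates
  the two modulo \<open>M\<close>.\<close>

lemma local_op_commutes:
  assumes synth: "spectral_synthesis A" and orbit: "closed (orbit A x)"
    and T: "T \<in> bounded_ops" and loc: "\<And>y. T y \<in> closure (orbit A y)"
    and a: "a \<in> A"
  shows "T (a x) = a (T x)"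
proof -
  obtain t where t: "t \<in> A" "T x = t x"
    using loc[of x] orbit by (auto simp: orbit_def)
  have "T (a x) \<in> orbit A x"
    using loc[of "a x"] closure_minimal[OF orbit_orbit_subset[OF mem_A(7)[OF _ a]] orbit] by blast
  then obtain b where b: "b \<in> A" "T (a x) = b x"
    by (auto simp: orbit_def)
  have "b - a \<cdot> t \<in> M" if M: "maximal_ideal A M" "annihilator x \<subseteq> M" for M
  proof -
    interpret op_algebra_maximal_ideal A M
      using M(1) by unfold_locales
    obtain l where l: "a - l *\<^sub>C \<one> \<in> M" using a by (rule Gelfand_Mazur)
    have "orbit A ((a - l *\<^sub>C \<one>) x) \<subseteq> orbit M x"
      by (rule orbit_orbit_subset[OF mem_M(6)[OF l]])
    then have "T ((a - l *\<^sub>C \<one>) x) \<in> closure (orbit M x)"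
      using loc closure_mono by blast
    also have "T ((a - l *\<^sub>C \<one>) x) = (b - l *\<^sub>C t) x"
      using b t T by (simp add: blinfun.diff_left blinfun.diff_right scaleC_blinfun.rep_eq bounded_ops_scaleC)
    finally have "b - l *\<^sub>C t \<in> M"
      using b(1) t(1) by (intro mem_if_eval_in_closure[OF orbit M(2)]) auto
    moreover have "(a - l *\<^sub>C \<one>) \<cdot> t \<in> M" using l t(1) by (rule mem_M)
    \<comment> \<open>The terms with \<open>l\<close> cancel, leaving
      \<open>b - a \<cdot> t\<close>.\<close>
    ultimately have "(b - l *\<^sub>C t) - (a - l *\<^sub>C \<one>) \<cdot> t \<in> M" by (rule mem_M)
    then show ?thesis
      by (simp add: blinfun_compose_simps scaleC_blinfun_compose)
  qed
  moreover have "annihilator x = A \<inter> \<Inter>{M. maximal_ideal A M \<and> annihilator x \<subseteq> M}"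
    using synth annihilator_ideal closed_annihilator by (simp add: spectral_synthesis_def)
  ultimately have "b - a \<cdot> t \<in> annihilator x"
    using a b(1) t(1) by auto
  then show ?thesis
    using b t by (simp add: annihilator_def blinfun.diff_left)
qed

lemma split_imp_hereditarily_reflexive:
  assumes synth: "spectral_synthesis A" and ssm: "split_strict_multiplicity_two A"
  shows "hereditarily_reflexive A"
  unfolding hereditarily_reflexive_def reflexive_def
proof (intro allI impI ballI)
  fix L and T :: "'a \<Rightarrow>\<^sub>L 'a"
  assume "csubspace L \<and> L \<subseteq> A \<and> strongly_closed L"
  then have L: "csubspace L" "L \<subseteq> A" "strongly_closed L" by auto
  assume T: "T \<in> bounded_ops" and loc: "\<forall>x. T x \<in> closure (orbit L x)"
  have locA: "T y \<in> closure (orbit A y)" for y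
  proof -
    have "orbit L y \<subseteq> orbit A y" using L(2) by (auto simp: orbit_def)
    then show ?thesis using loc closure_mono by blast
  qed
  obtain x1 x2 where closed: "closed (orbit A x1)" "closed (orbit A x2)"
    and sum: "{u + v | u v. u \<in> orbit A x1 \<and> v \<in> orbit A x2} = UNIV"
    and int: "orbit A x1 \<inter> orbit A x2 = {0}"
    using ssm by (auto simp: split_strict_multiplicity_two_def direct_sum_decomposition_def)
  obtain C where C: "\<forall>u\<in>orbit A x1. \<forall>v\<in>orbit A x2.
      norm u \<le> C * norm (u + v) \<and> norm v \<le> C * norm (u + v)"
    by (rule direct_sum_components_bounded[OF subspace_orbit[OF subspace_A] closed(1)
          subspace_orbit[OF subspace_A] closed(2) sum int])
  \<comment> \<open>Approximating at the single vector \<open>x1 + x2\<close> yields one sequence in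
    \<open>L\<close> that serves both generators.\<close>
  have "T (x1 + x2) \<in> closure (orbit L (x1 + x2))" using loc by blast
  then obtain y where y: "\<And>n. y n \<in> orbit L (x1 + x2)" "y \<longlonglongrightarrow> T (x1 + x2)"
    unfolding closure_sequential by blast
  have "\<exists>l. \<forall>n. l n \<in> L \<and> y n = l n (x1 + x2)"
    using y(1) by (intro choice) (auto simp: orbit_def)
  then obtain l where l: "\<And>n. l n \<in> L" "\<And>n. y n = l n (x1 + x2)" by blast
  have Tx: "T x1 \<in> orbit A x1" "T x2 \<in> orbit A x2"
    using locA[of x1] locA[of x2] closed by auto
  \<comment> \<open>The two errors lie in different summands, so \<open>C\<close> bounds each of
    them by the error at \<open>x1 + x2\<close>.\<close>
  have diff: "(l n - T) x1 \<in> orbit A x1" "(l n - T) x2 \<in> orbit A x2" for n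
    using l(1) L(2) Tx
    by (auto simp: blinfun.diff_left orbit_def intro!: subspace_diff[OF subspace_orbit[OF subspace_A], unfolded orbit_def])
  have null: "(\<lambda>n. C * norm (y n - T (x1 + x2))) \<longlonglongrightarrow> 0"
    by (rule tendsto_mult_right_zero[OF tendsto_norm_zero]) (use y(2) in \<open>simp add: LIM_zero\<close>)
  have eq: "y n - T (x1 + x2) = (l n - T) x1 + (l n - T) x2" for n
    by (simp add: l(2) blinfun.diff_left blinfun.add_right)
  have "(\<lambda>n. (l n - T) x1) \<longlonglongrightarrow> 0"
    by (rule Lim_null_comparison[OF _ null]) (simp add: eq C diff)
  then have lim1: "(\<lambda>n. l n x1) \<longlonglongrightarrow> T x1"
    by (simp add: blinfun.diff_left LIM_zero_iff)
  have "(\<lambda>n. (l n - T) x2) \<longlonglongrightarrow> 0"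
    by (rule Lim_null_comparison[OF _ null]) (simp add: eq C diff)
  then have lim2: "(\<lambda>n. l n x2) \<longlonglongrightarrow> T x2"
    by (simp add: blinfun.diff_left LIM_zero_iff)
  have "(\<lambda>n. l n z) \<longlonglongrightarrow> T z" for z
  proof -
    have "z \<in> {u + v | u v. u \<in> orbit A x1 \<and> v \<in> orbit A x2}" using sum by simp
    then obtain a b where ab: "a \<in> A" "b \<in> A" "z = a x1 + b x2"
      by (auto simp: orbit_def)
    \<comment> \<open>Both \<open>l n\<close> and \<open>T\<close> commute with \<open>a\<close> and
      \<open>b\<close>, so convergence at the generators spreads to every \<open>z\<close>.\<close>
    have "l n z = a (l n x1) + b (l n x2)" for n
    proof -
      have "l n \<in> A" using l(1) L(2) by blast
      then have "l n \<cdot> a = a \<cdot> l n" "l n \<cdot> b = b \<cdot> l n" using ab by (auto intro: commute)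
      then show ?thesis
        by (metis ab(3) blinfun.add_right blinfun_apply_blinfun_compose)
    qed
    moreover have "T z = a (T x1) + b (T x2)"
      using local_op_commutes[OF synth closed(1) T locA ab(1)]
        local_op_commutes[OF synth closed(2) T locA ab(2)]
      by (simp add: ab(3) blinfun.add_right)
    moreover have "(\<lambda>n. a (l n x1) + b (l n x2)) \<longlonglongrightarrow> a (T x1) + b (T x2)"
      by (intro tendsto_add blinfun.tendsto tendsto_const lim1 lim2)
    ultimately show ?thesis by simp
  qed
  with L(3) l(1) T show "T \<in> L" by (rule strongly_closed_sequentially)
qed

end

theorem corollary11:
  fixes A :: "('a :: complex_banach \<Rightarrow>\<^sub>L 'a) set"
  assumes "subalgebra A" and "abelian A" and "unital A" and "closed A"
    and "spectral_synthesis A"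
    and "split_strict_multiplicity_two A"
  shows "hereditarily_reflexive A"
proof -
  interpret unital_op_algebra A
    using assms(1-4) by unfold_locales
  show ?thesis using assms(5,6) by (rule split_imp_hereditarily_reflexive)
qed

end
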